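(* Consider the stylized power system described in the context. Define the constants $$l_1:=F^{-1}\left(\frac{c_F-c_F^-}{c_F^+-c_F^-}\right),$$ $$l_2:=\min_{l\ge 0}\ l:\ (v-c_F^+)F(l-\overline p_F)+c_F^+F(l)\ge c_I,$$ $$l_3:=\min_{l\ge l_1}\ l:\ c_F+(v-c_F^+)F(l-\overline p_F)-c_F^-(1-F(l))\ge c_I,$$ $$l_4:=\min_{l\ge l_1+\overline p_F}\ l:\ (v-c_F^-)F(l-\overline p_F)+c_F^-F(l)\ge c_I,$$ to which an infinite value is assigned in those cases where the corresponding minimization problem is infeasible. The efficient (stochastic) two-stage market (SM) prompts the following dispatch rule $(p_W,p_I,p_F)$, called the stochastic dispatch rule. Case $l_1\ge l_2$: 1. $(l,\,0,\,0)$ if $0\le l\le l_2$; 2. $(l_2,\,l-l_2,\,0)$ if $l_2<l\le \overline p_I+l_2$; 3. $(l-\overline p_I,\,\overline p_I,\,0)$ if $\overline p_I+l_2<l\le \overline p_I+l_1$; 4. $(l_1,\,\overline p_I,\,l-l_1-\overline p_I)$ if $\overline p_I+l_1<l\le \overline p_F+\overline p_I+l_1$; 5. $(l-\overline p_F-\overline p_I,\,\overline p_I,\,\overline p_F)$ if $l>\overline p_F+\overline p_I+l_1$. Case $l_1<l_2$: 6. $(l,\,0,\,0)$ if $0\le l\le l_1$; and, if moreover $l_3\le l_1+\overline p_F$: 7. $(l_1,\,0,\,l-l_1)$ if $l_1\le l\le l_3$; 8. $(l_1,\,l-l_3,\,l_3-l_1)$ if $l_3<l\le \overline p_I+l_3$;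 9. $(l_1,\,\overline p_I,\,l-l_1-\overline p_I)$ if $l_3+\overline p_I<l\le \overline p_I+\overline p_F+l_1$; 10. $(l-\overline p_I-\overline p_F,\,\overline p_I,\,\overline p_F)$ if $l>\overline p_I+\overline p_F+l_1$; while, if moreover $l_3>l_1+\overline p_F$: 11. $(l_1,\,0,\,l-l_1)$ if $l_1\le l\le \overline p_F+l_1$; and, when $l_4$ exists ($c_I\le v$): 12. $(l-\overline p_F,\,0,\,\overline p_F)$ if $\overline p_F+l_1\le l\le l_4$; 13. $(l_4-\overline p_F,\,l-l_4,\,\overline p_F)$ if $l_4\le l\le l_4+\overline p_I$; 14. $(l-\overline p_F-\overline p_I,\,\overline p_I,\,\overline p_F)$ if $l>l_4+\overline p_I$; and, when $l_4$ does not exist: 15. $(l-\overline p_F,\,0,\,\overline p_F)$ if $l>\overline p_F+l_1$.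
   Context: Stylized power system: transmission capacity is infinite; there are inflexible, flexible and stochastic generation technologies with capacities $\overline p_I>0$, $\overline p_F>0$, $\overline p_W>0$. The marginal costs of inflexible and flexible generation are $c_I>0$ and $c_F>0$; the marginal cost of stochastic production is zero. $c_F^+$ is the incremental cost incurred by the flexible capacity for marginally increasing its production for balancing (upward regulation), and $c_F^-$ is the incremental utility it obtains from marginally decreasing its production for balancing (downward regulation). Demand $l$ is inelastic and known with certainty; $v$ is the cost of involuntary curtailment of demand. It holds that $v>c_F^+\ge c_F\ge c_F^-\ge 0$. The stochastic power production is a bounded, nonnegative random variable $W$ on a probability space $(\Omega,\mathcal F,P)$, with values in $[0,\overline p_W]$, cumulative distribution function $F$ and probability density function $f$; $W(\omega)$ is its realization and $\int_\Omega g(\omega)f(\omega)\,d\omega$ denotes the expectation of $g$. $F^{-1}$ is the generalized inverse $F^{-1}(\alpha)=\inf\{x\in\mathbb R: F(x)\ge\alpha\}$. Stochastic two-stage market (SM): minimize over $p_I,p_F,p_W$ and $p_F^+(\omega),p_F^-(\omega),\Delta p_W(\omega),s(\omega)$ $$c_Ip_I+c_Fp_F+\int_\Omega\left(v\,s(\omega)+c_F^+p_F^+(\omega)-c_F^-p_F^-(\omega)\right)f(\omega)\,d\omega$$ subject to $p_F+p_I+p_W-l=0$, $0\le p_F\le\overline p_F$, $0\le p_I\le\overline p_I$, and for all $\omega\in\Omega$: $s(\omega)+p_F^+(\omega)-p_F^-(\omega)+\Delta p_W(\omega)=0$, $0\le p_F^-(\omega)\le p_F$, $0\le p_F^+(\omega)\le\overline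 p_F-p_F$, $0\le p_W+\Delta p_W(\omega)\le W(\omega)$, $0\le s(\omega)\le l$. Here $p_I,p_F,p_W$ are the forward dispatch quantities of inflexible, flexible and stochastic producers; $p_F^+,p_F^-$ are upward and downward regulation; $\Delta p_W$ is the real-time adjustment of stochastic production; $s$ is load curtailment. The dispatch rule prompted by (SM) is the optimal forward dispatch $(p_W,p_I,p_F)$ computed by (SM), as a function of the load $l$. *)

theory Defs
  imports "HOL-Probability.Probability"
begin

record power_system =
  cap_I :: real
  cap_F :: real
  cap_W :: real
  cost_I :: real
  cost_F :: real
  cost_up :: real    (* upward regulation *)
  cost_down :: real  (* utility of downward regulation *)
  voll :: real       (* cost of involuntary load curtailment *)

definition valid_power_system :: "power_system \<Rightarrow> bool" where
  "valid_power_system S \<longleftrightarrow>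
     0 < cap_I S \<and> 0 < cap_F S \<and> 0 < cap_W S \<and> 0 < cost_I S \<and> 0 < cost_F S \<and>
     cost_up S < voll S \<and> cost_F S \<le> cost_up S \<and> cost_down S \<le> cost_F S \<and> 0 \<le> cost_down S"

text \<open>
  The infimum is taken in the extended reals, so that the value at 0 is minus infinity when
  F is nonnegative (the infimum over all reals) rather than an unspecified real.
\<close>

definition gen_inverse :: "(real \<Rightarrow> real) \<Rightarrow> real \<Rightarrow> ereal" where
  "gen_inverse F \<alpha> = Inf (ereal ` {x. \<alpha> \<le> F x})"

text \<open>
  The value is meaningful only if the set has a least element or is empty; an infeasible
  minimization problem has value plus infinity.
\<close>

definition min_or_infinity :: "real set \<Rightarrow> ereal" where
  "min_or_infinity A = (if A = {} then \<infinity> else ereal (LEAST x. x \<in> A))"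

text \<open>
  A decision consists of the forward quantities pW, pI, pF and of the recourse functions: upward
  regulation u, downward regulation d, adjustment dW of the stochastic production, and load
  curtailment s. The forward quantity pW carries no bound of its own, and the recourse functions
  are required to be random variables, so that (being bounded) they have expectations.
\<close>

definition sm_feasible ::
  "power_system \<Rightarrow> 'a measure \<Rightarrow> ('a \<Rightarrow> real) \<Rightarrow> real \<Rightarrow> real \<times> real \<times> real \<Rightarrow>
   ('a \<Rightarrow> real) \<Rightarrow> ('a \<Rightarrow> real) \<Rightarrow> ('a \<Rightarrow> real) \<Rightarrow> ('a \<Rightarrow> real) \<Rightarrow> bool" where
  "sm_feasible S M W l = (\<lambda>(pW, pI, pF) u d dW s.
     pF + pI + pW - l = 0 \<and>
     0 \<le> pF \<and> pF \<le> cap_F S \<and>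
     0 \<le> pI \<and> pI \<le> cap_I S \<and>
     u \<in> borel_measurable M \<and> d \<in> borel_measurable M \<and>
     dW \<in> borel_measurable M \<and> s \<in> borel_measurable M \<and>
     (\<forall>\<omega>\<in>space M.
        s \<omega> + u \<omega> - d \<omega> + dW \<omega> = 0 \<and>
        0 \<le> d \<omega> \<and> d \<omega> \<le> pF \<and>
        0 \<le> u \<omega> \<and> u \<omega> \<le> cap_F S - pF \<and>
        0 \<le> pW + dW \<omega> \<and> pW + dW \<omega> \<le> W \<omega> \<and>
        0 \<le> s \<omega> \<and> s \<omega> \<le> l))"

definition sm_cost ::
  "power_system \<Rightarrow> 'a measure \<Rightarrow> real \<times> real \<times> real \<Rightarrow>
   ('a \<Rightarrow> real) \<Rightarrow> ('a \<Rightarrow> real) \<Rightarrow> ('a \<Rightarrow> real) \<Rightarrow> real" where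
  "sm_cost S M = (\<lambda>(pW, pI, pF) u d s.
     cost_I S * pI + cost_F S * pF +
     (\<integral>\<omega>. voll S * s \<omega> + cost_up S * u \<omega> - cost_down S * d \<omega> \<partial>M))"

definition sm_optimal_dispatch ::
  "power_system \<Rightarrow> 'a measure \<Rightarrow> ('a \<Rightarrow> real) \<Rightarrow> real \<Rightarrow> real \<times> real \<times> real \<Rightarrow> bool" where
  "sm_optimal_dispatch S M W l p \<longleftrightarrow>
     (\<exists>u d dW s. sm_feasible S M W l p u d dW s \<and>
        (\<forall>p' u' d' dW' s'. sm_feasible S M W l p' u' d' dW' s' \<longrightarrow>
           sm_cost S M p u d s \<le> sm_cost S M p' u' d' s'))"

end

theory Submission
  imports Defs
begin

text \<open>
  Write \<open>r = l - pI\<close> for the load left to flexible and stochastic production and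
  \<open>G x = E (max 0 (x - W))\<close>. Solving the recourse problem pointwise in merit order turns the
  total cost into
  \<open>cI pI + (cF - cd) pF + cd G r + (cu - cd) G (r - pF) + (v - cu) G (r - PF)\<close>, a convex
  function on the box \<open>0 \<le> pI \<le> PI\<close>, \<open>0 \<le> pF \<le> PF\<close>. Since \<open>F\<close> is a subgradient of \<open>G\<close>,
  optimality of a dispatch follows from sign conditions on the two partial derivatives, and
  \<open>l\<^sub>1, ..., l\<^sub>4\<close> are the points at which these derivatives change sign.
\<close>

section \<open>Expected shortage\<close>

lemma (in prob_space) integrable_shortage:
  fixes W :: "'a \<Rightarrow> real"
  assumes "W \<in> borel_measurable M" and "\<forall>\<omega>\<in>space M. 0 \<le> W \<omega>"
  shows "integrable M (\<lambda>\<omega>. max 0 (x - W \<omega>))"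
  using assms by (intro integrable_const_bound[where B="\<bar>x\<bar>"] AE_I2) auto

text \<open>In each outcome the indicator of \<open>W \<omega> \<le> x\<close> is a subgradient of
  the shortage at \<open>x\<close>. Its expectation is the distribution function.\<close>

lemma (in prob_space) expectation_shortage_ge_tangent:
  fixes W :: "'a \<Rightarrow> real"
  assumes W: "W \<in> borel_measurable M" and bnd: "\<forall>\<omega>\<in>space M. 0 \<le> W \<omega> \<and> W \<omega> \<le> B"
  shows "(\<integral>\<omega>. max 0 (x - W \<omega>) \<partial>M) + cdf (distr M borel W) x * (y - x)
    \<le> (\<integral>\<omega>. max 0 (y - W \<omega>) \<partial>M)"
proof -
  define A where "A = {\<omega>\<in>space M. W \<omega> \<le> x}"
  have A: "A \<in> sets M" unfolding A_def using W by measurable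
  have int: "integrable M (\<lambda>\<omega>. max 0 (z - W \<omega>))" for z
    using bnd by (intro integrable_shortage W) auto
  have intA: "integrable M (indicat_real A)"
    by (intro integrable_real_indicator A) (simp add: less_top[symmetric])
  have "cdf (distr M borel W) x = measure M A"
    unfolding cdf_def A_def using W
    by (subst measure_distr) (auto intro!: arg_cong[where f="measure M"])
  hence "(\<integral>\<omega>. max 0 (x - W \<omega>) \<partial>M) + cdf (distr M borel W) x * (y - x)
    = (\<integral>\<omega>. max 0 (x - W \<omega>) + indicat_real A \<omega> * (y - x) \<partial>M)"
    using int intA A by (simp add: sets.Int_space_eq2)
  also have "\<dots> \<le> (\<integral>\<omega>. max 0 (y - W \<omega>) \<partial>M)"
    by (intro integral_mono Bochner_Integration.integrable_add int integrable_mult_left intA)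
       (auto simp: A_def indicator_def max_def)
  finally show ?thesis .
qed

section \<open>The recourse problem\<close>

text \<open>Balance bounds the first shortage by \<open>u - d + s + pF\<close>. The second is at
  most \<open>u + s\<close> because \<open>d\<close> is nonnegative, and the third at most
  \<open>s\<close> because \<open>u\<close> is limited by the spare capacity. With the nonnegative
  weights \<open>cd\<close>, \<open>cu - cd\<close>, \<open>v - cu\<close> these bounds telescope to
  the recourse cost.\<close>

lemma recourse_cost_ge:
  fixes pI :: real
  assumes "0 \<le> cd" "cd \<le> cu" "cu \<le> v"
    and "pF + pI + pW = l" "s + u - d + dW = 0" "0 \<le> d" "d \<le> pF" "0 \<le> u" "u \<le> PF - pF"
    and "pW + dW \<le> w" "0 \<le> s"
  shows "- cd * pF + cd * max 0 (l - pI - w) + (cu - cd) * max 0 (l - pI - pF - w)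
      + (v - cu) * max 0 (l - pI - PF - w) \<le> v * s + cu * u - cd * d"
proof -
  have "cd * max 0 (l - pI - w) \<le> cd * (u - d + s + pF)"
    using assms by (intro mult_left_mono) auto
  moreover have "(cu - cd) * max 0 (l - pI - pF - w) \<le> (cu - cd) * (u + s)"
    using assms by (intro mult_left_mono) auto
  moreover have "(v - cu) * max 0 (l - pI - PF - w) \<le> (v - cu) * s"
    using assms by (intro mult_left_mono) auto
  ultimately show ?thesis by (simp add: algebra_simps)
qed

text \<open>Karush-Kuhn-Tucker conditions for the reduced cost: \<open>gF\<close> and
  \<open>gI\<close> are its slopes in \<open>pF\<close> and \<open>pI\<close>. Each vanishes in the
  interior, is nonnegative at 0 and nonpositive at capacity, which suffices by convexity.\<close>

lemma sm_optimal_dispatchI: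
  fixes S M W
  defines "F \<equiv> cdf (distr M borel W)"
  assumes S: "valid_power_system S" and P: "prob_space M" and W: "W \<in> borel_measurable M"
    and bnd: "\<forall>\<omega>\<in>space M. 0 \<le> W \<omega> \<and> W \<omega> \<le> B"
    and sum: "pW + pI + pF = l"
    and I: "0 \<le> pI" "pI \<le> cap_I S" "pI \<le> l"
    and Fl: "0 \<le> pF" "pF \<le> cap_F S"
    and gF: "gF = cost_F S - cost_down S - (cost_up S - cost_down S) * F pW"
      "0 \<le> gF \<or> pF = cap_F S" "gF \<le> 0 \<or> pF = 0"
    and gI: "gI = cost_I S - cost_down S * F (pW + pF) - (cost_up S - cost_down S) * F pW
        - (voll S - cost_up S) * F (pW + pF - cap_F S)"
      "0 \<le> gI \<or> pI = cap_I S" "gI \<le> 0 \<or> pI = 0"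
  shows "sm_optimal_dispatch S M W l (pW, pI, pF)"
proof -
  interpret prob_space M by fact
  note [measurable] = W
  define cI cF cu cd v PI PF where "cI = cost_I S" and "cF = cost_F S" and "cu = cost_up S"
    and "cd = cost_down S" and "v = voll S" and "PI = cap_I S" and "PF = cap_F S"
  note fold = this[symmetric]
  have c: "0 \<le> cd" "cd \<le> cu" "cu \<le> v" "0 < PF"
    using S unfolding valid_power_system_def fold by auto
  define G where "G x = (\<integral>\<omega>. max 0 (x - W \<omega>) \<partial>M)" for x
  have intG: "integrable M (\<lambda>\<omega>. max 0 (z - W \<omega>))" for z
    using bnd by (intro integrable_shortage W) auto
  have tangent: "G x + F x * (y - x) \<le> G y" for x y
    unfolding G_def F_def by (rule expectation_shortage_ge_tangent[OF W bnd])
  \<comment> \<open>The least recourse cost in outcome \<open>\<omega>\<close>: a lower bound by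
    \<open>recourse_cost_ge\<close>, attained by the recourse constructed below.\<close>
  define q where "q qI qF \<omega> = - cd * qF + cd * max 0 (l - qI - W \<omega>)
      + (cu - cd) * max 0 (l - qI - qF - W \<omega>) + (v - cu) * max 0 (l - qI - PF - W \<omega>)" for qI qF \<omega>
  have intq: "integrable M (q qI qF)" for qI qF
    unfolding q_def by (intro Bochner_Integration.integrable_add integrable_mult_right intG integrable_const)
  have Eq: "(\<integral>\<omega>. q qI qF \<omega> \<partial>M) = - cd * qF + cd * G (l - qI)
      + (cu - cd) * G (l - qI - qF) + (v - cu) * G (l - qI - PF)" for qI qF
    unfolding q_def G_def using intG by (simp add: prob_space)
  define J where "J qI qF = cI * qI + cF * qF + (\<integral>\<omega>. q qI qF \<omega> \<partial>M)" for qI qF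
  \<comment> \<open>The weighted tangent inequalities for the three \<open>G\<close> terms leave the
    linear remainder \<open>gF * (qF - pF) + gI * (qI - pI)\<close>, nonnegative by the sign
    conditions.\<close>
  have J_min: "J pI pF \<le> J qI qF" if "0 \<le> qI" "qI \<le> PI" "0 \<le> qF" "qF \<le> PF" for qI qF
  proof -
    have "cd * (G (l - pI) + F (l - pI) * (pI - qI)) \<le> cd * G (l - qI)"
      using tangent[of "l - pI" "l - qI"] c by (intro mult_left_mono) auto
    moreover have "(cu - cd) * (G (l - pI - pF) + F (l - pI - pF) * (pI + pF - qI - qF))
        \<le> (cu - cd) * G (l - qI - qF)"
      using tangent[of "l - pI - pF" "l - qI - qF"] c
      by (intro mult_left_mono) (auto simp: algebra_simps)
    moreover have "(v - cu) * (G (l - pI - PF) + F (l - pI - PF) * (pI - qI))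
        \<le> (v - cu) * G (l - qI - PF)"
      using tangent[of "l - pI - PF" "l - qI - PF"] c by (intro mult_left_mono) auto
    moreover have "0 \<le> gF * (qF - pF)"
      using gF(2,3) that Fl unfolding fold by (auto simp: zero_le_mult_iff)
    moreover have "0 \<le> gI * (qI - pI)"
      using gI(2,3) that I unfolding fold by (auto simp: zero_le_mult_iff)
    moreover have "pW = l - pI - pF" using sum by simp
    ultimately show ?thesis
      unfolding J_def Eq gF(1) gI(1) fold by (simp add: algebra_simps)
  qed
  \<comment> \<open>Merit order: stochastic output is \<open>min (l - pI) (W \<omega>)\<close>,
    which is nonnegative because \<open>pI \<le> l\<close>. Flexible output covers the remaining
    shortage up to \<open>PF\<close>, and the rest is curtailed.\<close>
  define s where "s \<omega> = max 0 (l - pI - PF - W \<omega>)" for \<omega>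
  define u where "u \<omega> = max 0 (l - pI - pF - W \<omega>) - s \<omega>" for \<omega>
  define d where "d \<omega> = pF - max 0 (l - pI - W \<omega>) + max 0 (l - pI - pF - W \<omega>)" for \<omega>
  define dW where "dW \<omega> = d \<omega> - u \<omega> - s \<omega>" for \<omega>
  have "sm_feasible S M W l (pW, pI, pF) u d dW s"
    unfolding sm_feasible_def prod.case fold
  proof (intro conjI ballI)
    show "u \<in> borel_measurable M" "d \<in> borel_measurable M" "dW \<in> borel_measurable M"
      "s \<in> borel_measurable M"
      unfolding u_def[abs_def] s_def[abs_def] d_def[abs_def] dW_def[abs_def] by measurable
  qed (use sum I Fl bnd c in \<open>auto simp: fold s_def u_def d_def dW_def max_def\<close>)
  moreover have cost: "sm_cost S M (pW, pI, pF) u d s = J pI pF"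
  proof -
    have "v * s \<omega> + cu * u \<omega> - cd * d \<omega> = q pI pF \<omega>" for \<omega>
      unfolding u_def s_def d_def q_def by (simp add: algebra_simps)
    thus ?thesis unfolding sm_cost_def J_def by (simp add: fold)
  qed
  moreover have "J pI pF \<le> sm_cost S M p' u' d' s'"
    if feas: "sm_feasible S M W l p' u' d' dW' s'" for p' u' d' dW' s'
  proof -
    obtain qW qI qF where p': "p' = (qW, qI, qF)" by (cases p') auto
    note f = feas[unfolded sm_feasible_def p' prod.case fold]
    have m[measurable]: "u' \<in> borel_measurable M" "d' \<in> borel_measurable M" "s' \<in> borel_measurable M"
      using f by auto
    have "integrable M u'" using f by (intro integrable_const_bound[where B=PF] AE_I2) (use m in \<open>fastforce+\<close>)
    moreover have "integrable M d'"
      using f by (intro integrable_const_bound[where B=PF] AE_I2) (use m in \<open>fastforce+\<close>)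
    moreover have "integrable M s'"
      using f by (intro integrable_const_bound[where B=l] AE_I2) (use m in \<open>fastforce+\<close>)
    moreover have "q qI qF \<omega> \<le> v * s' \<omega> + cu * u' \<omega> - cd * d' \<omega>" if "\<omega> \<in> space M" for \<omega>
      unfolding q_def by (rule recourse_cost_ge[where pW=qW and dW="dW' \<omega>"]) (use f c that in auto)
    ultimately have "(\<integral>\<omega>. q qI qF \<omega> \<partial>M) \<le> (\<integral>\<omega>. v * s' \<omega> + cu * u' \<omega> - cd * d' \<omega> \<partial>M)"
      by (intro integral_mono intq) auto
    with J_min[of qI qF] f show ?thesis
      unfolding p' sm_cost_def J_def by (auto simp: fold)
  qed
  ultimately show ?thesis unfolding sm_optimal_dispatch_def by metis
qed

section \<open>Thresholds\<close>

text \<open>Reduces each threshold to comparisons of \<open>H x\<close> with \<open>c\<close>. By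
  \<open>below\<close>, the feasible set is the superlevel set of \<open>H\<close>, which is closed
  by continuity and bounded below by \<open>b\<close>; so its minimum exists unless it is
  empty.\<close>

lemma min_or_infinity_threshold:
  fixes H :: "real \<Rightarrow> real" and a :: ereal and c :: real
  defines "m \<equiv> min_or_infinity {x. a \<le> ereal x \<and> c \<le> H x}"
  assumes mono: "mono H" and cont: "continuous_on UNIV H"
    and below: "\<And>x. ereal x \<le> a \<Longrightarrow> H x < c" and b: "H b < c"
  shows "ereal x < m \<longleftrightarrow> H x < c" and "ereal x \<le> m \<Longrightarrow> H x \<le> c" and "m \<noteq> - \<infinity>"
proof -
  let ?A = "{x. c \<le> H x}"
  have A: "{x. a \<le> ereal x \<and> c \<le> H x} = ?A"
    using below by (force simp: not_less[symmetric])
  show "m \<noteq> - \<infinity>" by (simp add: m_def min_or_infinity_def)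
  have *: "(ereal x < m \<longleftrightarrow> H x < c) \<and> (ereal x \<le> m \<longrightarrow> H x \<le> c)" for x
  proof (cases "?A = {}")
    case True
    thus ?thesis by (auto simp: m_def min_or_infinity_def A not_le intro: less_imp_le)
  next
    case False
    have cl: "closed ?A" by (intro closed_Collect_le cont continuous_intros)
    have bdd: "bdd_below ?A"
      using b monoD[OF mono] by (intro bdd_belowI[of _ b]) (smt (verit) mem_Collect_eq)
    define r where "r = Inf ?A"
    have rA: "c \<le> H r" using closed_contains_Inf[OF False bdd cl] by (simp add: r_def)
    have rle: "r \<le> y" if "c \<le> H y" for y using that bdd by (simp add: r_def cInf_lower)
    have "(LEAST x. x \<in> ?A) = r" by (rule Least_equality) (use rA rle in auto)
    hence m: "m = ereal r" using False by (auto simp: m_def min_or_infinity_def A)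
    \<comment> \<open>The level \<open>c\<close> is not reached to the left of \<open>r\<close>, so
      the left limit is at most \<open>c\<close>; together with \<open>rA\<close> this gives
      equality at \<open>r\<close>.\<close>
    have "H r \<le> c"
    proof (rule tendsto_upperbound)
      show "(H \<longlongrightarrow> H r) (at_left r)"
        using cont by (simp add: continuous_on_eq_continuous_within continuous_within filterlim_at_split)
      show "eventually (\<lambda>x. H x \<le> c) (at_left r)"
        using rle by (auto simp: eventually_at_filter intro!: always_eventually) (meson linorder_not_less nle_le)
    qed simp
    with rA rle m monoD[OF mono] show ?thesis
      by (smt (verit) ereal_less_eq(3) less_ereal.simps(1))
  qed
  show "ereal x < m \<longleftrightarrow> H x < c" and "ereal x \<le> m \<Longrightarrow> H x \<le> c" using * by auto
qed

text \<open>Brings \<open>l\<^sub>1\<close> under the same threshold lemma as the other three: by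
  continuity the infimum is attained, and \<open>b\<close> keeps it away from minus
  infinity.\<close>

lemma gen_inverse_eq_min_or_infinity:
  assumes "mono F" "continuous_on UNIV F" "F b < \<alpha>"
  shows "gen_inverse F \<alpha> = min_or_infinity {x. - \<infinity> \<le> ereal x \<and> \<alpha> \<le> F x}" (is "_ = ?m")
proof -
  have thr: "ereal x < ?m \<longleftrightarrow> F x < \<alpha>" for x
    by (rule min_or_infinity_threshold(1)) (use assms in auto)
  have "?m \<noteq> - \<infinity>" by (rule min_or_infinity_threshold(3)) (use assms in auto)
  show ?thesis unfolding gen_inverse_def
  proof (rule Inf_eqI)
    show "?m \<le> i" if "i \<in> ereal ` {x. \<alpha> \<le> F x}" for i using that thr by (metis (mono_tags, lifting) imageE mem_Collect_eq not_less)
    show "y \<le> ?m" if y: "\<And>i. i \<in> ereal ` {x. \<alpha> \<le> F x} \<Longrightarrow> y \<le> i" for y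
    proof (cases ?m)
      case (real r)
      with thr[of r] y show ?thesis by auto
    qed (use \<open>?m \<noteq> - \<infinity>\<close> in auto)
  qed
qed

text \<open>A law with a density has no atoms. The passage from \<open>borel\<close> to
  \<open>lborel\<close> is harmless since both have the same measurable sets.\<close>

lemma continuous_cdf_distributed_lborel:
  assumes "prob_space M" "distributed M lborel W f"
  shows "continuous_on UNIV (cdf (distr M borel W))"
proof -
  interpret prob_space M by fact
  have W: "W \<in> borel_measurable M" using distributed_measurable[OF assms(2)] by simp
  interpret D: real_distribution "distr M borel W" using W by (rule real_distribution_distr)
  have "distr M borel W = distr M lborel W" by (rule distr_cong) auto
  also have "\<dots> = density lborel f" using assms(2) by (rule distributed_distr_eq_density)
  finally have eq: "distr M borel W = density lborel f" .
  have f: "f \<in> borel_measurable lborel" using distributed_borel_measurable[OF assms(2)] by simp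
  have "emeasure (distr M borel W) {x} = 0" for x
    unfolding eq using f
    by (subst emeasure_density) (auto intro!: nn_integral_null_set simp: null_sets_def)
  hence "measure (distr M borel W) {x} = 0" for x by (simp add: measure_def)
  thus ?thesis
    by (auto simp: continuous_on_eq_continuous_within D.isCont_cdf)
qed

theorem theorem1:
  fixes S :: power_system
    and M :: "'a measure"
    and W :: "'a \<Rightarrow> real"
    and f :: "real \<Rightarrow> ennreal"
    and F :: "real \<Rightarrow> real"
    and cI cF cu cd v PI PF :: real
    and l\<^sub>1 l\<^sub>2 l\<^sub>3 l\<^sub>4 :: ereal
    and opt :: "real \<Rightarrow> real \<times> real \<times> real \<Rightarrow> bool"
    and l :: real
  assumes "valid_power_system S"
    and "prob_space M"
    and "distributed M lborel W f"
    and "\<forall>\<omega>\<in>space M. 0 \<le> W \<omega> \<and> W \<omega> \<le> cap_W S"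
    and "0 \<le> l"
    and "F = cdf (distr M borel W)"
    and "cI = cost_I S" and "cF = cost_F S" and "cu = cost_up S" and "cd = cost_down S"
    and "v = voll S" and "PI = cap_I S" and "PF = cap_F S"
    and "l\<^sub>1 = gen_inverse F ((cF - cd) / (cu - cd))"
    and "l\<^sub>2 = min_or_infinity {l. 0 \<le> l \<and> (v - cu) * F (l - PF) + cu * F l \<ge> cI}"
    and "l\<^sub>3 = min_or_infinity
           {l. l\<^sub>1 \<le> ereal l \<and> cF + (v - cu) * F (l - PF) - cd * (1 - F l) \<ge> cI}"
    and "l\<^sub>4 = min_or_infinity
           {l. l\<^sub>1 + ereal PF \<le> ereal l \<and> (v - cd) * F (l - PF) + cd * F l \<ge> cI}"
    and "opt = sm_optimal_dispatch S M W"
  shows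
    "(l\<^sub>1 \<ge> l\<^sub>2 \<longrightarrow>
        (l \<le> l\<^sub>2 \<longrightarrow> opt l (l, 0, 0)) \<and>
        (l\<^sub>2 < l \<and> l \<le> PI + l\<^sub>2 \<longrightarrow> opt l (real_of_ereal l\<^sub>2, l - real_of_ereal l\<^sub>2, 0)) \<and>
        (PI + l\<^sub>2 < l \<and> l \<le> PI + l\<^sub>1 \<longrightarrow> opt l (l - PI, PI, 0)) \<and>
        (PI + l\<^sub>1 < l \<and> l \<le> PF + PI + l\<^sub>1 \<longrightarrow>
           opt l (real_of_ereal l\<^sub>1, PI, l - real_of_ereal l\<^sub>1 - PI)) \<and>
        (l > PF + PI + l\<^sub>1 \<longrightarrow> opt l (l - PF - PI, PI, PF))) \<and>
     (l\<^sub>1 < l\<^sub>2 \<longrightarrow>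
        (l \<le> l\<^sub>1 \<longrightarrow> opt l (l, 0, 0)) \<and>
        (l\<^sub>3 \<le> l\<^sub>1 + PF \<longrightarrow>
           (l\<^sub>1 \<le> l \<and> l \<le> l\<^sub>3 \<longrightarrow> opt l (real_of_ereal l\<^sub>1, 0, l - real_of_ereal l\<^sub>1)) \<and>
           (l\<^sub>3 < l \<and> l \<le> PI + l\<^sub>3 \<longrightarrow>
              opt l (real_of_ereal l\<^sub>1, l - real_of_ereal l\<^sub>3, real_of_ereal l\<^sub>3 - real_of_ereal l\<^sub>1)) \<and>
           (l\<^sub>3 + PI < l \<and> l \<le> PI + PF + l\<^sub>1 \<longrightarrow>
              opt l (real_of_ereal l\<^sub>1, PI, l - real_of_ereal l\<^sub>1 - PI)) \<and>
           (l > PI + PF + l\<^sub>1 \<longrightarrow> opt l (l - PI - PF, PI, PF))) \<and>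
        (l\<^sub>3 > l\<^sub>1 + PF \<longrightarrow>
           (l\<^sub>1 \<le> l \<and> l \<le> PF + l\<^sub>1 \<longrightarrow> opt l (real_of_ereal l\<^sub>1, 0, l - real_of_ereal l\<^sub>1)) \<and>
           (l\<^sub>4 < \<infinity> \<longleftrightarrow> cI \<le> v) \<and>
           (l\<^sub>4 < \<infinity> \<longrightarrow>
              (PF + l\<^sub>1 \<le> l \<and> l \<le> l\<^sub>4 \<longrightarrow> opt l (l - PF, 0, PF)) \<and>
              (l\<^sub>4 \<le> l \<and> l \<le> l\<^sub>4 + PI \<longrightarrow> opt l (real_of_ereal l\<^sub>4 - PF, l - real_of_ereal l\<^sub>4, PF)) \<and>
              (l > l\<^sub>4 + PI \<longrightarrow> opt l (l - PF - PI, PI, PF))) \<and>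
           (l\<^sub>4 = \<infinity> \<longrightarrow>
              (l > PF + l\<^sub>1 \<longrightarrow> opt l (l - PF, 0, PF)))))"
proof -
  have c: "0 < PI" "0 < PF" "0 < cI" "cu < v" "cF \<le> cu" "cd \<le> cF" "0 \<le> cd"
    using assms(1) unfolding valid_power_system_def assms(7-13) by auto

  \<comment> \<open>Regularity and boundary values of the distribution function\<close>
  interpret prob_space M by fact
  have W: "W \<in> borel_measurable M" using distributed_measurable[OF assms(3)] by simp
  interpret D: real_distribution "distr M borel W" using W by (rule real_distribution_distr)
  have F_cdf: "F = cdf (distr M borel W)" by fact
  have F_mono: "F x \<le> F y" if "x \<le> y" for x y
    using that unfolding F_cdf by (rule D.cdf_nondecreasing)
  have F_cont: "continuous_on UNIV F"
    unfolding F_cdf by (rule continuous_cdf_distributed_lborel) fact+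
  have F_nonneg: "0 \<le> F x" and F_le_1: "F x \<le> 1" for x
    unfolding F_cdf by (simp_all add: D.cdf_nonneg D.cdf_bounded_prob)
  have F_prob: "F x = prob {\<omega>\<in>space M. W \<omega> \<le> x}" for x
    unfolding F_cdf cdf_def using W
    by (subst measure_distr) (auto intro!: arg_cong[where f="measure M"])
  have "F x = 0" if "x < 0" for x
  proof -
    have "{\<omega>\<in>space M. W \<omega> \<le> x} = {}" using assms(4) that by (auto dest!: bspec)
    thus ?thesis by (simp only: F_prob measure_empty)
  qed
  \<comment> \<open>\<open>W\<close> may take the value 0, so \<open>F 0 = 0\<close> has to come
    from continuity, by passing to the closure of the negative axis.\<close>
  hence "{..<0} \<subseteq> {x. F x \<le> 0}" by auto
  moreover have "closed {x. F x \<le> 0}" by (intro closed_Collect_le F_cont continuous_intros)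
  ultimately have "closure {..<0} \<subseteq> {x. F x \<le> 0}" by (rule closure_minimal)
  hence F_0: "F x = 0" if "x \<le> 0" for x
  proof -
    from that have "x \<in> closure {..<0}" by simp
    hence "F x \<le> 0" using \<open>closure {..<0} \<subseteq> {x. F x \<le> 0}\<close> by blast
    thus ?thesis using F_nonneg[of x] by simp
  qed
  have F_1: "F x = 1" if "cap_W S \<le> x" for x
  proof -
    have "{\<omega>\<in>space M. W \<omega> \<le> x} = space M"
      using assms(4) by (auto intro!: order_trans[OF _ that])
    thus ?thesis by (simp only: F_prob prob_space)
  qed

  \<comment> \<open>Marginal terms of the reduced cost\<close>
  define A B E where "A x = cd * F x" and "B x = (cu - cd) * F x" and "E x = (v - cu) * F (x - PF)"
    for x
  have mono: "A x \<le> A y" "B x \<le> B y" "E x \<le> E y" if "x \<le> y" for x y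
    using that c unfolding A_def B_def E_def by (auto intro!: mult_left_mono F_mono)
  have cont: "continuous_on UNIV A" "continuous_on UNIV B" "continuous_on UNIV E"
    "continuous_on UNIV (\<lambda>x. B (x - PF))"
    unfolding A_def[abs_def] B_def[abs_def] E_def[abs_def]
    by (intro continuous_intros F_cont continuous_on_compose2[OF F_cont]; simp)+
  have zero: "A x = 0" "B x = 0" "E x = 0" if "x \<le> 0" for x
    using that c by (auto simp: A_def B_def E_def F_0)

  \<comment> \<open>The slope in \<open>pF\<close> is \<open>cF - cd - B pW\<close>. The slope in
    \<open>pI\<close> is \<open>cI\<close> minus \<open>A r + B pW + E r\<close>, where
    \<open>r = pW + pF\<close> is the load left after inflexible production.\<close>
  have optI: "opt l (pW, pI, pF)"
    if "pW + pI + pF = l" "0 \<le> pI" "pI \<le> PI" "pI \<le> l" "0 \<le> pF" "pF \<le> PF"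
      "B pW \<le> cF - cd \<or> pF = PF" "cF - cd \<le> B pW \<or> pF = 0"
      "A (pW + pF) + B pW + E (pW + pF) \<le> cI \<or> pI = PI"
      "cI \<le> A (pW + pF) + B pW + E (pW + pF) \<or> pI = 0"
    for pW pI pF
    unfolding \<open>opt = _\<close>
    by (rule sm_optimal_dispatchI[OF assms(1,2) W assms(4)])
       (use that in \<open>auto simp: F_cdf[symmetric] assms(7-13)[symmetric] A_def B_def E_def\<close>)

  \<comment> \<open>The thresholds as crossing points of the marginal terms\<close>
  have l1: "(ereal x \<le> l\<^sub>1 \<longrightarrow> B x \<le> cF - cd) \<and> (l\<^sub>1 \<le> ereal x \<longrightarrow> cF - cd \<le> B x) \<and>
      (l\<^sub>1 = - \<infinity> \<or> (0 < l\<^sub>1 \<and> l\<^sub>1 < \<infinity>))" for x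
  \<comment> \<open>The quotient is positive exactly when \<open>cd < cF\<close>; then
    \<open>F\<close> climbs from 0 at 0 to 1 at \<open>cap_W S\<close>, which places
    \<open>l\<^sub>1\<close> in between. Otherwise every real qualifies and the infimum is minus
    infinity.\<close>
  proof (cases "0 < (cF - cd) / (cu - cd)")
    case True
    hence pos: "0 < cu - cd" "0 < cF - cd" using c by (auto simp: zero_less_divide_iff)
    have eq: "l\<^sub>1 = min_or_infinity {x. - \<infinity> \<le> ereal x \<and> (cF - cd) / (cu - cd) \<le> F x}"
      unfolding assms(14)
      by (rule gen_inverse_eq_min_or_infinity[where b=0]) (use True F_0 F_mono F_cont in \<open>auto intro: monoI\<close>)
    note thr = min_or_infinity_threshold[of F "- \<infinity>" "(cF - cd) / (cu - cd)" 0, folded eq]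
    have t: "ereal y < l\<^sub>1 \<longleftrightarrow> F y < (cF - cd) / (cu - cd)"
      "ereal y \<le> l\<^sub>1 \<Longrightarrow> F y \<le> (cF - cd) / (cu - cd)" for y
      by (rule thr; use True F_0 F_mono F_cont in \<open>auto intro: monoI\<close>)+
    have "(cF - cd) / (cu - cd) \<le> 1" using c pos by simp
    hence "l\<^sub>1 \<le> ereal (cap_W S)" using t(1)[of "cap_W S"] F_1[of "cap_W S"] by (simp add: not_less[symmetric])
    hence "l\<^sub>1 < \<infinity>" by auto
    moreover have "0 < l\<^sub>1" using t(1)[of 0] F_0[of 0] True by (simp add: zero_ereal_def)
    ultimately show ?thesis using t[of x] pos
      by (auto simp: B_def field_simps not_less[symmetric])
  next
    case False
    \<comment> \<open>This includes \<open>cu = cd\<close>, where the quotient is the junk value 0.\<close>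
    hence "cF = cd" using c by (auto simp: zero_less_divide_iff)
    moreover have "l\<^sub>1 = - \<infinity>"
    proof -
      have "l\<^sub>1 \<le> ereal x" for x
        unfolding assms(14) gen_inverse_def using \<open>cF = cd\<close> F_nonneg by (intro Inf_lower) auto
      thus ?thesis by (cases l\<^sub>1) (auto, metis ereal_less_eq(3) le_minus_one_simps(3) add.commute lt_ex not_less)
    qed
    ultimately show ?thesis using F_nonneg c by (auto simp: B_def)
  qed
  hence l1_le: "ereal x \<le> l\<^sub>1 \<Longrightarrow> B x \<le> cF - cd" and l1_ge: "l\<^sub>1 \<le> ereal x \<Longrightarrow> cF - cd \<le> B x"
    and l1_cases: "l\<^sub>1 = - \<infinity> \<or> (0 < l\<^sub>1 \<and> l\<^sub>1 < \<infinity>)" for x by blast+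

  \<comment> \<open>Slope in \<open>pI\<close> along \<open>pF = 0\<close>,
    \<open>pW = x\<close>.\<close>
  have l2_eq: "l\<^sub>2 = min_or_infinity {x. 0 \<le> ereal x \<and> cI \<le> A x + B x + E x}"
    unfolding assms(15) A_def B_def E_def by (simp add: algebra_simps)
  note thr2 = min_or_infinity_threshold[of "\<lambda>x. A x + B x + E x" 0 cI 0, folded l2_eq]
  have l2: "ereal x < l\<^sub>2 \<longleftrightarrow> A x + B x + E x < cI" "ereal x \<le> l\<^sub>2 \<Longrightarrow> A x + B x + E x \<le> cI"
    "l\<^sub>2 \<noteq> - \<infinity>" for x
    by (rule thr2; use zero c in \<open>auto intro!: monoI add_mono mono continuous_intros cont\<close>)+

  \<comment> \<open>Slope in \<open>pI\<close> with \<open>pW\<close> held at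
    \<open>l\<^sub>1\<close>, where \<open>B pW\<close> equals \<open>cF - cd\<close>. At
    \<open>L1\<close> the sum is still below \<open>cI\<close> because
    \<open>l\<^sub>1 < l\<^sub>2\<close>.\<close>
  have l3: "(ereal x < l\<^sub>3 \<longleftrightarrow> A x + (cF - cd) + E x < cI) \<and> (ereal x \<le> l\<^sub>3 \<longrightarrow> A x + (cF - cd) + E x \<le> cI)
      \<and> l\<^sub>3 \<noteq> - \<infinity>"
    if L1: "l\<^sub>1 = ereal L1" and "l\<^sub>1 < l\<^sub>2" for L1 x
  proof -
    have eq: "l\<^sub>3 = min_or_infinity {x. l\<^sub>1 \<le> ereal x \<and> cI \<le> A x + (cF - cd) + E x}"
      unfolding assms(16) A_def B_def E_def by (simp add: algebra_simps)
    have below: "A y + (cF - cd) + E y < cI" if "y \<le> L1" for y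
      using l2(1)[of L1] mono[OF that] l1_ge[of L1] L1 \<open>l\<^sub>1 < l\<^sub>2\<close> by simp
    note thr = min_or_infinity_threshold[of "\<lambda>x. A x + (cF - cd) + E x" l\<^sub>1 cI L1, folded eq]
    have "ereal x < l\<^sub>3 \<longleftrightarrow> A x + (cF - cd) + E x < cI" "ereal x \<le> l\<^sub>3 \<Longrightarrow> A x + (cF - cd) + E x \<le> cI"
      "l\<^sub>3 \<noteq> - \<infinity>"
      by (rule thr; use below L1 in \<open>auto intro!: monoI add_mono mono continuous_intros cont\<close>)+
    thus ?thesis by blast
  qed

  \<comment> \<open>Slope in \<open>pI\<close> along \<open>pF = PF\<close>,
    \<open>pW = x - PF\<close>. Up to \<open>l\<^sub>1 + PF\<close> the term
    \<open>B (x - PF)\<close> is at most \<open>cF - cd\<close>, so the strict inequality for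
    \<open>l\<^sub>3\<close> carries over.\<close>
  have l4: "(ereal x < l\<^sub>4 \<longleftrightarrow> A x + B (x - PF) + E x < cI) \<and> (ereal x \<le> l\<^sub>4 \<longrightarrow> A x + B (x - PF) + E x \<le> cI)
      \<and> l\<^sub>4 \<noteq> - \<infinity>"
    if "l\<^sub>1 < l\<^sub>2" and l13: "l\<^sub>1 + PF < l\<^sub>3" for x
  proof -
    have eq: "l\<^sub>4 = min_or_infinity {x. l\<^sub>1 + ereal PF \<le> ereal x \<and> cI \<le> A x + B (x - PF) + E x}"
      unfolding assms(17) A_def B_def E_def by (simp add: algebra_simps)
    have below: "A y + B (y - PF) + E y < cI" if y: "ereal y \<le> l\<^sub>1 + ereal PF" for y
    proof (cases l\<^sub>1)
      case (real L1)
      hence "y \<le> L1 + PF" using y by simp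
      moreover from this have "y - PF \<le> L1" by simp
      ultimately show ?thesis
        using l3[OF real \<open>l\<^sub>1 < l\<^sub>2\<close>, of "L1 + PF"] l13 real mono[of y "L1 + PF"] l1_le[of "y - PF"]
        by simp
    qed (use y l1_cases in auto)
    note thr = min_or_infinity_threshold[of "\<lambda>x. A x + B (x - PF) + E x" "l\<^sub>1 + ereal PF" cI 0, folded eq]
    have "ereal x < l\<^sub>4 \<longleftrightarrow> A x + B (x - PF) + E x < cI" "ereal x \<le> l\<^sub>4 \<Longrightarrow> A x + B (x - PF) + E x \<le> cI"
      "l\<^sub>4 \<noteq> - \<infinity>"
      by (rule thr; use below zero c in \<open>auto intro!: monoI add_mono mono continuous_intros cont\<close>)+
    thus ?thesis by blast
  qed

  \<comment> \<open>Verification of the dispatch rule, case by case\<close>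
  note arith = c \<open>0 \<le> l\<close>
  show ?thesis
  proof (intro conjI impI)
    assume l21: "l\<^sub>2 \<le> l\<^sub>1"
    obtain L1 where L1: "l\<^sub>1 = ereal L1" "0 < L1" using l21 l1_cases l2(3) by (cases l\<^sub>1) auto
    obtain L2 where L2: "l\<^sub>2 = ereal L2" using l21 L1 l2(3) by (cases l\<^sub>2) auto
    have L21: "L2 \<le> L1" using l21 L1 L2 by simp
    have b1: "x \<le> L1 \<Longrightarrow> B x \<le> cF - cd" "L1 \<le> x \<Longrightarrow> cF - cd \<le> B x" for x
      using l1_le[of x] l1_ge[of x] L1 by auto
    have b2: "x \<le> L2 \<Longrightarrow> A x + B x + E x \<le> cI" "L2 \<le> x \<Longrightarrow> cI \<le> A x + B x + E x" for x
      using l2(1,2)[of x] L2 by (auto simp: not_less[symmetric])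
    \<comment> \<open>Positivity ensures \<open>l - L2 \<le> l\<close>, the condition
      \<open>pI \<le> l\<close> of \<open>optI\<close>.\<close>
    have "0 < L2" using l2(1)[of 0] L2 zero[of 0] c by simp
    note pos = this L1(2) L21
    \<comment> \<open>Past \<open>L1\<close> only the arguments of \<open>A\<close> and
      \<open>E\<close> grow while \<open>pW\<close> stays at \<open>L1\<close>, so the marginal sum
      remains at least \<open>cI\<close>.\<close>
    note cmp = mono[of L1 "l - PI"] b2(2)[of L1]
    { assume "ereal l \<le> l\<^sub>2"
      thus "opt l (l, 0, 0)" using b1[of l] b2[of l] L2 L21 arith by (intro optI) auto }
    { assume "l\<^sub>2 < ereal l \<and> ereal l \<le> ereal PI + l\<^sub>2"
      thus "opt l (real_of_ereal l\<^sub>2, l - real_of_ereal l\<^sub>2, 0)"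
        using b1[of L2] b2[of L2] L2 pos arith by (intro optI) auto }
    { assume "ereal PI + l\<^sub>2 < ereal l \<and> ereal l \<le> ereal PI + l\<^sub>1"
      thus "opt l (l - PI, PI, 0)"
        using b1[of "l - PI"] b2[of "l - PI"] L1 L2 pos arith by (intro optI) auto }
    { assume "ereal PI + l\<^sub>1 < ereal l \<and> ereal l \<le> ereal (PF + PI) + l\<^sub>1"
      thus "opt l (real_of_ereal l\<^sub>1, PI, l - real_of_ereal l\<^sub>1 - PI)"
        using b1[of L1] cmp L1 pos arith by (intro optI) auto }
    { assume "ereal (PF + PI) + l\<^sub>1 < ereal l"
      thus "opt l (l - PF - PI, PI, PF)"
        using b1[of "l - PF - PI"] mono[of L1 "l - PF - PI"] cmp L1 pos arith by (intro optI) auto }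
  next
    assume l12: "l\<^sub>1 < l\<^sub>2"
    { assume "ereal l \<le> l\<^sub>1"
      thus "opt l (l, 0, 0)"
        using l1_le[of l] l2(2)[of l] l12 arith by (intro optI) auto }
    have l11: "opt l (real_of_ereal l\<^sub>1, 0, l - real_of_ereal l\<^sub>1)"
      if L: "l\<^sub>1 \<le> ereal l" "ereal l \<le> l\<^sub>3" "ereal l \<le> PF + l\<^sub>1"
    proof -
      obtain L1 where L1: "l\<^sub>1 = ereal L1" using L l1_cases by (cases l\<^sub>1) auto
      show ?thesis
        using L l3[OF L1 l12, of l] l1_le[of L1] l1_ge[of L1] L1 arith by (intro optI) auto
    qed
    { assume l31: "l\<^sub>3 \<le> l\<^sub>1 + ereal PF"
      \<comment> \<open>Otherwise \<open>l\<^sub>3\<close> would be minus infinity, a value that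
        \<open>min_or_infinity\<close> never takes.\<close>
      have "l\<^sub>1 \<noteq> - \<infinity>" using l31 by (auto simp: assms(16) min_or_infinity_def split: if_splits)
      then obtain L1 where L1: "l\<^sub>1 = ereal L1" "0 < L1" using l1_cases by (cases l\<^sub>1) auto
      note l3 = l3[OF L1(1) l12]
      obtain L3 where L3: "l\<^sub>3 = ereal L3" using l31 L1 l3 by (cases l\<^sub>3) auto
      have L31: "L3 \<le> L1 + PF" using l31 L1 L3 by simp
      have b1: "x \<le> L1 \<Longrightarrow> B x \<le> cF - cd" "L1 \<le> x \<Longrightarrow> cF - cd \<le> B x" for x
        using l1_le[of x] l1_ge[of x] L1 by auto
      have b3: "x \<le> L3 \<Longrightarrow> A x + (cF - cd) + E x \<le> cI" "L3 \<le> x \<Longrightarrow> cI \<le> A x + (cF - cd) + E x" for x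
        using l3[of x] L3 by (auto simp: not_less[symmetric])
      have "L1 < L3" using l3[of L1] l2(1)[of L1] l12 b1[of L1] L1 L3 by simp
      note pos = this L1(2) L31
      { assume "l\<^sub>1 \<le> ereal l \<and> ereal l \<le> l\<^sub>3"
        thus "opt l (real_of_ereal l\<^sub>1, 0, l - real_of_ereal l\<^sub>1)"
          using L1 L3 L31 by (intro l11) auto }
      { assume "l\<^sub>3 < ereal l \<and> ereal l \<le> ereal PI + l\<^sub>3"
        thus "opt l (real_of_ereal l\<^sub>1, l - real_of_ereal l\<^sub>3, real_of_ereal l\<^sub>3 - real_of_ereal l\<^sub>1)"
          using b1[of L1] b3[of L3] L1 L3 pos arith by (intro optI) auto }
      { assume "l\<^sub>3 + ereal PI < ereal l \<and> ereal l \<le> ereal (PI + PF) + l\<^sub>1"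
        thus "opt l (real_of_ereal l\<^sub>1, PI, l - real_of_ereal l\<^sub>1 - PI)"
          using b1[of L1] b3(2)[of "l - PI"] L1 L3 pos arith by (intro optI) auto }
      { assume "ereal (PI + PF) + l\<^sub>1 < ereal l"
        thus "opt l (l - PI - PF, PI, PF)"
          using b1(2)[of "l - PI - PF"] b3(2)[of "l - PI"] L1 L3 pos arith by (intro optI) auto }
    next
      assume l13: "l\<^sub>1 + ereal PF < l\<^sub>3"
      note l4 = l4[OF l12 l13]
      { assume "l\<^sub>1 \<le> ereal l \<and> ereal l \<le> ereal PF + l\<^sub>1"
        thus "opt l (real_of_ereal l\<^sub>1, 0, l - real_of_ereal l\<^sub>1)"
          using l13 by (intro l11) (auto simp: add.commute) }
      \<comment> \<open>If \<open>l\<^sub>1\<close> is minus infinity, \<open>l - PF\<close> may be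
        negative; feasibility admits a negative forward quantity \<open>pW\<close>.\<close>
      have l12': "opt l (l - PF, 0, PF)" if "ereal PF + l\<^sub>1 \<le> ereal l" "ereal l \<le> l\<^sub>4"
      proof -
        have "l\<^sub>1 \<le> ereal (l - PF)" using that(1) by (cases l\<^sub>1) auto
        thus ?thesis using l1_ge[of "l - PF"] l4[of l] that arith by (intro optI) auto
      qed
      \<comment> \<open>The weights \<open>cd\<close>, \<open>cu - cd\<close>, \<open>v - cu\<close>
        sum to \<open>v\<close>, the largest value of the marginal sum, reached once all three
        values of \<open>F\<close> are 1.\<close>
      show "l\<^sub>4 < \<infinity> \<longleftrightarrow> cI \<le> v"
      proof
        assume "l\<^sub>4 < \<infinity>"
        then obtain x where "l\<^sub>4 = ereal x" using l4 by (cases l\<^sub>4) auto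
        hence "cI \<le> A x + B (x - PF) + E x" using l4[of x] by simp
        also have "\<dots> \<le> cd * 1 + (cu - cd) * 1 + (v - cu) * 1"
          unfolding A_def B_def E_def using c F_le_1 by (intro add_mono mult_left_mono) auto
        finally show "cI \<le> v" by simp
      next
        assume "cI \<le> v"
        moreover have "A (cap_W S + PF) + B (cap_W S + PF - PF) + E (cap_W S + PF) = v"
          using c by (simp add: A_def B_def E_def F_1)
        ultimately show "l\<^sub>4 < \<infinity>" using l4[of "cap_W S + PF"] by auto
      qed
      { assume "l\<^sub>4 < \<infinity>"
        then obtain L4 where L4: "l\<^sub>4 = ereal L4" using l4 by (cases l\<^sub>4) auto
        have b4: "x \<le> L4 \<Longrightarrow> A x + B (x - PF) + E x \<le> cI" "L4 \<le> x \<Longrightarrow> cI \<le> A x + B (x - PF) + E x" for x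
          using l4[of x] L4 by (auto simp: not_less[symmetric])
        have "0 < L4" using l4[of 0] L4 zero c by simp
        \<comment> \<open>Keeping \<open>pF\<close> at capacity requires \<open>pW\<close> at or
          above \<open>l\<^sub>1\<close>; this holds from \<open>L4\<close> on because
          \<open>l\<^sub>1 + PF < l\<^sub>4\<close>.\<close>
        have b1: "cF - cd \<le> B (x - PF)" if "L4 \<le> x" for x
        proof (cases l\<^sub>1)
          case (real L1)
          have "L1 + PF < L4"
          proof -
            have "A (L1 + PF) + B (L1 + PF - PF) + E (L1 + PF) < cI"
              using l3[OF real l12, of "L1 + PF"] l13 l1_le[of L1] real by simp
            thus ?thesis using l4[of "L1 + PF"] L4 by simp
          qed
          thus ?thesis using that real by (intro l1_ge) simp
        qed (use l1_cases l1_ge in auto)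
        { assume "ereal PF + l\<^sub>1 \<le> ereal l \<and> ereal l \<le> l\<^sub>4"
          thus "opt l (l - PF, 0, PF)" by (intro l12') auto }
        { assume "l\<^sub>4 \<le> ereal l \<and> ereal l \<le> l\<^sub>4 + ereal PI"
          thus "opt l (real_of_ereal l\<^sub>4 - PF, l - real_of_ereal l\<^sub>4, PF)"
            using b1[of L4] b4[of L4] L4 \<open>0 < L4\<close> arith by (intro optI) auto }
        { assume "l\<^sub>4 + ereal PI < ereal l"
          thus "opt l (l - PF - PI, PI, PF)"
            using b1[of "l - PI"] b4(2)[of "l - PI"] L4 \<open>0 < L4\<close> arith
            by (intro optI) (auto simp: algebra_simps) }
      next
        assume "l\<^sub>4 = \<infinity>" "ereal PF + l\<^sub>1 < ereal l"
        thus "opt l (l - PF, 0, PF)" by (intro l12') auto }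
    }
  qed
qed

end
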